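(* Let $(T,\mathcal{A},\mu)$ be a complete finite purely atomic measure space consisting of a countable disjoint family of atoms $(T_k)_{k\in\mathbb{N}}$. Let $\Phi:T\times\mathbb{R}^n\rightrightarrows\mathbb{R}^m$ be a set-valued normal integrand, let $(\bar x,\bar y)\in\operatorname{gph}E_\Phi$, and let $\bar{\mathsf y}\in\mathcal{S}_\Phi(\bar x,\bar y)$. If $\Phi$ is integrably quasi-Lipschitzian around $(\bar x,\bar{\mathsf y})$, then there exist $\gamma>0$ and $\ell\in L^1(T,\mathbb{R}_+)$ such that for all $k\in\mathbb{N}$ $$\Phi_t(x)\cap\mathbb{B}_{\frac{\gamma}{\mu(T_k)}}(\bar{\mathsf y}(t))\subset\Phi_t(x')+\ell(t)\|x-x'\|\mathbb{B}\quad\text{for all } x,x'\in\mathbb{B}_{\frac{\gamma}{\ell(t)+1}}(\bar x)\text{ and a.e. } t\in T_k.\qquad( * )$$ Conversely, if $( * )$ holds for all $k\in\mathbb{N}$ with some $\gamma>0$ and some $\ell\in L^\infty(T,\mathbb{R}_+)$, then $\Phi$ is integrably quasi-Lipschitzian around $(\bar x,\bar{\mathsf y})$.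
   Context: $\mathbb{R}_+:=\{\alpha\in\mathbb{R}:\alpha>0\}$; $L^p(T,\cdot)$ are the usual Lebesgue spaces; vectors are identified with constant functions; $\mathbb{B}_r(\cdot)$ is the closed ball, $\mathbb{B}$ the closed unit ball. For $\Phi:T\times\mathbb{R}^n\rightrightarrows\mathbb{R}^m$ write $\Phi_t:=\Phi(t,\cdot)$. $\Phi$ is a set-valued normal integrand if $\operatorname{gph}\Phi_t$ is closed for all $t\in T$ and $\operatorname{gph}\Phi\in\mathcal{A}\otimes\mathcal{B}(\mathbb{R}^n\times\mathbb{R}^m)$. $E_\Phi(x):=\int_T\Phi_t(x)d\mu=\{\int_T\mathsf{y}\,d\mu:\mathsf{y}\in L^1(T,\mathbb{R}^m),\ \mathsf{y}(t)\in\Phi_t(x)\text{ a.e.}\}$ (Aumann integral). $\mathcal{S}_\Phi(x,y):=\{\mathsf{y}\in L^1(T,\mathbb{R}^m):\int_T\mathsf{y}\,d\mu=y,\ \mathsf{y}(t)\in\Phi_t(x)\text{ for a.e. }t\}$. Regular normal cone: $\hat N(\bar z;\Omega)=\{z^*:\limsup_{z\to\bar z,z\in\Omega}\langle z^*,z-\bar z\rangle/\|z-\bar z\|\le0\}$ for $\bar z\in\Omega$, $\emptyset$ otherwise. Limiting normal cone: $N(\bar z;\Omega)=\{z^*:\exists z_k\to\bar z,\ z_k^*\to z^*,\ z_k^*\in\hat N(z_k;\Omega)\}$. Limiting coderivative of $G$ at $(x,y)\in\operatorname{gph}G$: $D^*G(x,y)(y^* )=\{x^*:(x^*,-y^* )\in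 N((x,y);\operatorname{gph}G)\}$. $\Phi$ is integrably quasi-Lipschitzian around $(\bar x,\bar{\mathsf y})$ if there exist $\eta>0$ and $\ell\in L^1(T,\mathbb{R}_+)$ such that $\sup\{\|x^*\|:x^*\in D^*\Phi_t(\mathsf{x}(t),\mathsf{y}(t))(\mathsf{y}^*(t))\}\le\ell(t)\|\mathsf{y}^*(t)\|$ for a.e. $t\in T$ whenever $\mathsf{x}\in L^\infty(T,\mathbb{R}^n)$ with $\|\mathsf{x}-\bar x\|_\infty\le\eta$, $\mathsf{y}\in L^1(T,\mathbb{R}^m)$ with $\|\mathsf{y}-\bar{\mathsf y}\|_1\le\eta$ and $\mathsf{y}(t)\in\Phi_t(\mathsf{x}(t))$ a.e., and $\mathsf{y}^*\in L^\infty(T,\mathbb{R}^m)$ (the inequality being regarded as satisfied when the set is empty). *)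

theory Defs
  imports "HOL-Analysis.Analysis" "HOL-Probability.Essential_Supremum"
begin

definition measure_atom :: "'t measure \<Rightarrow> 't set \<Rightarrow> bool" where
  "measure_atom M A \<longleftrightarrow> A \<in> sets M \<and> 0 < emeasure M A \<and>
     (\<forall>B\<in>sets M. B \<subseteq> A \<longrightarrow> emeasure M B < emeasure M A \<longrightarrow> emeasure M B = 0)"

text \<open>Members of the Lebesgue spaces are represented by functions, not by classes modulo
  null sets; accordingly, conditions on their values are imposed almost everywhere.\<close>

definition Linf_norm :: "'t measure \<Rightarrow> ('t \<Rightarrow> 'b::euclidean_space) \<Rightarrow> ereal" where
  "Linf_norm M f = esssup M (\<lambda>t. ereal (norm (f t)))"

definition Linf :: "'t measure \<Rightarrow> ('t \<Rightarrow> 'b::euclidean_space) set" where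
  "Linf M = {f \<in> borel_measurable M. Linf_norm M f < \<infinity>}"

definition L1 :: "'t measure \<Rightarrow> ('t \<Rightarrow> 'b::euclidean_space) set" where
  "L1 M = {f. integrable M f}"

definition L1_norm :: "'t measure \<Rightarrow> ('t \<Rightarrow> 'b::euclidean_space) \<Rightarrow> real" where
  "L1_norm M f = (\<integral>t. norm (f t) \<partial>M)"

text \<open>Here the half-line of positive reals is open: \<open>0\<close> is excluded.\<close>

definition L1_pos :: "'t measure \<Rightarrow> ('t \<Rightarrow> real) set" where
  "L1_pos M = {l \<in> L1 M. AE t in M. 0 < l t}"

definition Linf_pos :: "'t measure \<Rightarrow> ('t \<Rightarrow> real) set" where
  "Linf_pos M = {l \<in> Linf M. AE t in M. 0 < l t}"

definition gph :: "('a \<Rightarrow> 'b set) \<Rightarrow> ('a \<times> 'b) set" where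
  "gph G = {(x, y). y \<in> G x}"

text \<open>At an isolated point of the set the filter is trivial and the upper limit is
  \<open>-\<infinity>\<close>, so that the cone is the whole space.\<close>

definition regular_normal_cone :: "'a::euclidean_space \<Rightarrow> 'a set \<Rightarrow> 'a set" where
  "regular_normal_cone zb \<Omega> =
     (if zb \<in> \<Omega>
      then {zs. Limsup (at zb within \<Omega>) (\<lambda>z. ereal ((zs \<bullet> (z - zb)) / norm (z - zb))) \<le> 0}
      else {})"

definition limiting_normal_cone :: "'a::euclidean_space \<Rightarrow> 'a set \<Rightarrow> 'a set" where
  "limiting_normal_cone zb \<Omega> =
     {zs. \<exists>z s. z \<longlonglongrightarrow> zb \<and> s \<longlonglongrightarrow> zs \<and> (\<forall>k::nat. s k \<in> regular_normal_cone (z k) \<Omega>)}"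

definition coderivative ::
  "('a::euclidean_space \<Rightarrow> 'b::euclidean_space set) \<Rightarrow> 'a \<Rightarrow> 'b \<Rightarrow> 'b \<Rightarrow> 'a set" where
  "coderivative G x y ys = {xs. (xs, - ys) \<in> limiting_normal_cone (x, y) (gph G)}"

text \<open>Values of an integrand outside \<open>space M\<close> are unconstrained and irrelevant.\<close>

definition normal_integrand ::
  "'t measure \<Rightarrow> ('t \<Rightarrow> 'a::euclidean_space \<Rightarrow> 'b::euclidean_space set) \<Rightarrow> bool" where
  "normal_integrand M \<Phi> \<longleftrightarrow>
     (\<forall>t\<in>space M. closed (gph (\<Phi> t))) \<and>
     {(t, z). t \<in> space M \<and> z \<in> gph (\<Phi> t)} \<in> sets (M \<Otimes>\<^sub>M (borel :: ('a \<times> 'b) measure))"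

definition aumann_integral ::
  "'t measure \<Rightarrow> ('t \<Rightarrow> 'a::euclidean_space \<Rightarrow> 'b::euclidean_space set) \<Rightarrow> 'a \<Rightarrow> 'b set" where
  "aumann_integral M \<Phi> x = {(\<integral>t. y t \<partial>M) | y. y \<in> L1 M \<and> (AE t in M. y t \<in> \<Phi> t x)}"

definition selections ::
  "'t measure \<Rightarrow> ('t \<Rightarrow> 'a::euclidean_space \<Rightarrow> 'b::euclidean_space set) \<Rightarrow> 'a \<Rightarrow> 'b \<Rightarrow>
    ('t \<Rightarrow> 'b) set" where
  "selections M \<Phi> x y =
     {ys \<in> L1 M. (\<integral>t. ys t \<partial>M) = y \<and> (AE t in M. ys t \<in> \<Phi> t x)}"

text \<open>The supremum is taken in the extended reals, where the supremum of the empty set is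
  \<open>-\<infinity>\<close>; the inequality thus holds whenever the coderivative has empty value.\<close>

definition integrably_quasi_Lipschitzian ::
  "'t measure \<Rightarrow> ('t \<Rightarrow> 'a::euclidean_space \<Rightarrow> 'b::euclidean_space set) \<Rightarrow> 'a \<Rightarrow>
    ('t \<Rightarrow> 'b) \<Rightarrow> bool" where
  "integrably_quasi_Lipschitzian M \<Phi> xb yb \<longleftrightarrow>
     (\<exists>\<eta>>0. \<exists>l\<in>L1_pos M. \<forall>x\<in>Linf M. \<forall>y\<in>L1 M. \<forall>ys\<in>Linf M.
        Linf_norm M (\<lambda>t. x t - xb) \<le> ereal \<eta> \<longrightarrow>
        L1_norm M (\<lambda>t. y t - yb t) \<le> \<eta> \<longrightarrow>
        (AE t in M. y t \<in> \<Phi> t (x t)) \<longrightarrow>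
        (AE t in M. (SUP xs \<in> coderivative (\<Phi> t) (x t) (y t) (ys t). ereal (norm xs))
                      \<le> ereal (l t * norm (ys t))))"

text \<open>The sum on the right-hand side of the inclusion is the Minkowski sum. The radius of the
  ball containing \<open>x\<close> and \<open>x'\<close> depends on \<open>t\<close>, hence the quantifier over \<open>t\<close> is the outer one.\<close>

definition Lipschitz_inclusion_on ::
  "'t measure \<Rightarrow> 't set \<Rightarrow> ('t \<Rightarrow> 'a::euclidean_space \<Rightarrow> 'b::euclidean_space set) \<Rightarrow> 'a \<Rightarrow>
    ('t \<Rightarrow> 'b) \<Rightarrow> real \<Rightarrow> ('t \<Rightarrow> real) \<Rightarrow> bool" where
  "Lipschitz_inclusion_on M A \<Phi> xb yb \<gamma> l \<longleftrightarrow>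
     (AE t in M. t \<in> A \<longrightarrow>
        (\<forall>x \<in> cball xb (\<gamma> / (l t + 1)). \<forall>x' \<in> cball xb (\<gamma> / (l t + 1)).
           \<Phi> t x \<inter> cball (yb t) (\<gamma> / measure M A)
             \<subseteq> \<Phi> t x' + (*\<^sub>R) (l t * norm (x - x')) ` cball 0 1))"

end

theory Submission
  imports Defs
begin

text \<open>On an atom of positive measure \<open>\<mu>\<close> the integrand, the reference selection and \<open>l\<close> are almost
  everywhere constant, so that quasi-Lipschitzness with radius \<open>\<eta>\<close> amounts to the coderivative
  bound \<open>l\<close> for one closed multifunction \<open>G\<close> at the points of its graph within \<open>\<eta>\<close> of \<open>xb\<close> and
  \<open>\<eta> / \<mu>\<close> of the selection. From this bound the Lipschitz inclusion follows, with \<open>2 (l + 1)\<close> in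
  place of \<open>l\<close>, by minimizing \<open>norm (u - x') + c * (norm (v - y))\<^sup>2\<close> over the graph; since the measure
  is finite, one \<open>\<gamma>\<close> serves all atoms. Conversely, testing a regular normal against points of the
  graph that the Lipschitz inclusion provides in the direction of its first component bounds that
  component, and the bound passes to limiting normals. Boundedness of \<open>l\<close> keeps the radii
  \<open>\<gamma> / (l + 1)\<close> away from \<open>0\<close>.\<close>

section \<open>Almost everywhere constancy on atoms\<close>

lemma atom_null_or_conull:
  assumes "finite_measure M" and A: "measure_atom M A" and B: "B \<in> sets M"
  shows "(AE t in M. t \<in> A \<longrightarrow> t \<in> B) \<or> (AE t in M. t \<in> A \<longrightarrow> t \<notin> B)"
proof -
  interpret finite_measure M by fact
  have sA: "A \<in> sets M" using A by (simp add: measure_atom_def)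
  have AB: "A \<inter> B \<in> sets M" using sA B by blast
  show ?thesis
  proof (cases "emeasure M (A \<inter> B) < emeasure M A")
    case True
    then have "emeasure M (A \<inter> B) = 0"
      using A AB by (auto simp: measure_atom_def)
    then have "A \<inter> B \<in> null_sets M" using AB by auto
    from AE_not_in[OF this] show ?thesis by auto
  next
    case False
    have "emeasure M (A \<inter> B) \<le> emeasure M A" using sA by (intro emeasure_mono) auto
    with False have "emeasure M (A \<inter> B) = emeasure M A" by auto
    \<comment> \<open>Finiteness of the measure permits the subtraction: equal measures leave a null
      difference.\<close>
    then have "emeasure M (A - A \<inter> B) = 0"
      using AB sA by (subst emeasure_Diff) auto
    then have "A - A \<inter> B \<in> null_sets M" using AB sA by auto
    from AE_not_in[OF this] show ?thesis by auto
  qed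
qed

text \<open>An atom is not a null set. When \<open>P\<close> does not mention \<open>t\<close>, this
  turns an almost everywhere statement on the atom into a plain one.\<close>

lemma atom_AE_imp_ex:
  assumes "measure_atom M A" and "AE t in M. t \<in> A \<longrightarrow> P t"
  shows "\<exists>t\<in>A. P t"
proof (rule ccontr)
  assume "\<not> ?thesis"
  then have "AE t in M. t \<notin> A" using assms(2) by (auto elim: eventually_mono)
  moreover have "A \<in> sets M" "emeasure M A \<noteq> 0" using assms(1) by (auto simp: measure_atom_def)
  ultimately show False by (metis AE_iff_null_sets null_setsD1)
qed

text \<open>The sets with this property form a \<open>\<sigma>\<close>-algebra that contains the rectangles, so that no
  measurable projection is needed.\<close>

lemma atom_AE_section_const:
  assumes fin: "finite_measure M" and A: "measure_atom M A" and E: "E \<in> sets (M \<Otimes>\<^sub>M N)"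
  shows "\<exists>B. AE t in M. t \<in> A \<longrightarrow> Pair t -` E = B"
  using E unfolding sets_pair_measure
proof (induction rule: sigma_sets.induct)
  case (Basic a)
  then obtain C D where a: "a = C \<times> D" and C: "C \<in> sets M" by auto
  show ?case
    using atom_null_or_conull[OF fin A C]
  proof
    assume "AE t in M. t \<in> A \<longrightarrow> t \<in> C"
    then have "AE t in M. t \<in> A \<longrightarrow> Pair t -` a = D" by (rule eventually_mono) (auto simp: a)
    then show ?case by blast
  next
    assume "AE t in M. t \<in> A \<longrightarrow> t \<notin> C"
    then have "AE t in M. t \<in> A \<longrightarrow> Pair t -` a = {}" by (rule eventually_mono) (auto simp: a)
    then show ?case by blast
  qed
next
  case Empty
  then show ?case by auto
next
  case (Compl a)
  then obtain B where "AE t in M. t \<in> A \<longrightarrow> Pair t -` a = B" by blast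
  \<comment> \<open>For \<open>t\<close> outside \<open>space M\<close> the section of the
    complement would be empty instead of \<open>space N - B\<close>; hence
    \<open>AE_space\<close>.\<close>
  with AE_space have "AE t in M. t \<in> A \<longrightarrow> Pair t -` (space M \<times> space N - a) = space N - B"
    by eventually_elim auto
  then show ?case by blast
next
  case (Union a)
  then obtain B where "\<And>i. AE t in M. t \<in> A \<longrightarrow> Pair t -` a i = B i" by metis
  then have "AE t in M. \<forall>i. t \<in> A \<longrightarrow> Pair t -` a i = B i" unfolding AE_all_countable by blast
  then have "AE t in M. t \<in> A \<longrightarrow> Pair t -` (\<Union>i. a i) = (\<Union>i. B i)"
    by eventually_elim auto
  then show ?case by blast
qed

text \<open>The graph of \<open>f\<close> is measurable in the product, and its sections are the
  singletons of the values of \<open>f\<close>. Constant sections therefore mean constant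
  values.\<close>

lemma atom_AE_const:
  fixes f :: "'t \<Rightarrow> 'b::euclidean_space"
  assumes "finite_measure M" and "measure_atom M A" and f: "f \<in> borel_measurable M"
  shows "\<exists>c. AE t in M. t \<in> A \<longrightarrow> f t = c"
proof -
  have "{p \<in> space (M \<Otimes>\<^sub>M borel). f (fst p) = snd p} \<in> sets (M \<Otimes>\<^sub>M borel)"
    using f by measurable
  from atom_AE_section_const[OF assms(1,2) this] obtain B
    where "AE t in M. t \<in> A \<longrightarrow> Pair t -` {p \<in> space (M \<Otimes>\<^sub>M borel). f (fst p) = snd p} = B"
    by blast
  with AE_space have "AE t in M. t \<in> A \<longrightarrow> {f t} = B"
    by eventually_elim (auto simp: space_pair_measure)
  then have "AE t in M. t \<in> A \<longrightarrow> f t = the_elem B"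
    by (rule eventually_mono) (metis the_elem_eq)
  then show ?thesis by blast
qed

text \<open>The sections of the measurable set in \<open>normal_integrand\<close> are the graphs of
  the multifunctions \<open>\<Phi> t\<close>, so one graph serves almost the whole atom.\<close>

lemma atom_AE_normal_integrand_const:
  assumes "finite_measure M" and "measure_atom M A" and \<Phi>: "normal_integrand M \<Phi>"
  shows "\<exists>G. closed (gph G) \<and> (AE t in M. t \<in> A \<longrightarrow> \<Phi> t = G)"
proof -
  obtain B where "AE t in M. t \<in> A \<longrightarrow> Pair t -` {(t, z). t \<in> space M \<and> z \<in> gph (\<Phi> t)} = B"
    using atom_AE_section_const[OF assms(1,2)] \<Phi> unfolding normal_integrand_def by blast
  with AE_space have B: "AE t in M. t \<in> A \<longrightarrow> t \<in> space M \<and> gph (\<Phi> t) = B"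
    by eventually_elim auto
  define G where "G = (\<lambda>x. {y. (x, y) \<in> B})"
  have "gph G = B" by (auto simp: gph_def G_def)
  \<comment> \<open>Closedness is inherited from a single good \<open>t\<close>, which exists
    because the atom is not null.\<close>
  moreover have "closed B"
    using atom_AE_imp_ex[OF assms(2) B] \<Phi> by (auto simp: normal_integrand_def)
  moreover have "AE t in M. t \<in> A \<longrightarrow> \<Phi> t = G"
    using B by (rule eventually_mono) (auto simp: G_def gph_def)
  ultimately show ?thesis by blast
qed

section \<open>Normal cones, coderivatives and Lipschitz estimates\<close>

lemma regular_normal_cone_iff:
  "s \<in> regular_normal_cone z \<Omega> \<longleftrightarrow>
    z \<in> \<Omega> \<and> (\<forall>e>0. \<forall>\<^sub>F w in at z within \<Omega>. s \<bullet> (w - z) \<le> e * norm (w - z))"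
proof -
  let ?q = "\<lambda>w. ereal ((s \<bullet> (w - z)) / norm (w - z))"
  have ev: "(\<forall>\<^sub>F w in at z within \<Omega>. ?q w \<le> ereal e) \<longleftrightarrow>
      (\<forall>\<^sub>F w in at z within \<Omega>. s \<bullet> (w - z) \<le> e * norm (w - z))" for e
    unfolding eventually_at_filter
    by (intro eventually_cong[OF always_eventually]) (auto simp: divide_le_eq)
  \<comment> \<open>At an isolated point the filter is trivial and both sides hold.\<close>
  have "Limsup (at z within \<Omega>) ?q \<le> 0 \<longleftrightarrow> (\<forall>e>0. \<forall>\<^sub>F w in at z within \<Omega>. ?q w \<le> ereal e)"
  proof
    assume L: "Limsup (at z within \<Omega>) ?q \<le> 0"
    show "\<forall>e>0. \<forall>\<^sub>F w in at z within \<Omega>. ?q w \<le> ereal e"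
    proof (intro allI impI)
      fix e :: real assume "e > 0"
      then have "\<forall>\<^sub>F w in at z within \<Omega>. ?q w < ereal e"
        using L by (intro Limsup_lessD) (auto intro: le_less_trans)
      then show "\<forall>\<^sub>F w in at z within \<Omega>. ?q w \<le> ereal e" by (rule eventually_mono) simp
    qed
  next
    assume R: "\<forall>e>0. \<forall>\<^sub>F w in at z within \<Omega>. ?q w \<le> ereal e"
    show "Limsup (at z within \<Omega>) ?q \<le> 0"
    proof (rule ereal_le_epsilon2)
      fix e :: real assume "e > 0"
      with R show "Limsup (at z within \<Omega>) ?q \<le> 0 + ereal e" by (simp add: Limsup_bounded)
    qed
  qed
  then show ?thesis unfolding regular_normal_cone_def ev by (cases "z \<in> \<Omega>") simp_all
qed

text \<open>To first order \<open>s \<bullet> (w - z)\<close> is \<open>g z - g w\<close>, which is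
  nonpositive on the set; the remainder is at most \<open>e * norm (w - z)\<close> near
  \<open>z\<close>.\<close>

lemma minimizer_regular_normal:
  assumes "z \<in> \<Omega>" and min: "\<And>w. w \<in> \<Omega> \<Longrightarrow> g z \<le> g w"
    and der: "(g has_derivative (\<lambda>h. - (s \<bullet> h))) (at z)"
  shows "s \<in> regular_normal_cone z \<Omega>"
  unfolding regular_normal_cone_iff
proof (intro conjI allI impI)
  fix e :: real assume "e > 0"
  with der obtain d where d: "d > 0"
    "\<And>w. norm (w - z) < d \<Longrightarrow> norm (g w - g z + s \<bullet> (w - z)) \<le> e * norm (w - z)"
    unfolding has_derivative_at_alt by force
  have "\<forall>\<^sub>F w in at z within \<Omega>. w \<in> \<Omega> \<and> norm (w - z) < d"
    unfolding eventually_at using d(1) by (auto simp: dist_norm)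
  then show "\<forall>\<^sub>F w in at z within \<Omega>. s \<bullet> (w - z) \<le> e * norm (w - z)"
  proof eventually_elim
    case (elim w)
    with d(2)[of w] min[of w] show ?case by (simp add: abs_le_iff)
  qed
qed fact

lemma regular_normal_imp_coderivative:
  assumes "(xs, - ys) \<in> regular_normal_cone (x, y) (gph G)"
  shows "xs \<in> coderivative G x y ys"
proof -
  have "(\<lambda>_::nat. (x, y)) \<longlonglongrightarrow> (x, y)" "(\<lambda>_::nat. (xs, - ys)) \<longlonglongrightarrow> (xs, - ys)" by auto
  with assms show ?thesis
    unfolding coderivative_def limiting_normal_cone_def by blast
qed

text \<open>The quadratic term keeps the objective smooth in \<open>v\<close>. Its coefficient \<open>c\<close> is chosen so that the
  \<open>v\<close>-gradient has norm at most \<open>1 / (l + 1)\<close> at the minimizer, whereas the \<open>u\<close>-gradient has norm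
  \<open>1\<close> unless \<open>u = x'\<close>; the coderivative bound excludes the latter case.\<close>

lemma coderivative_bound_imp_Lipschitz:
  fixes G :: "'a::euclidean_space \<Rightarrow> 'b::euclidean_space set"
  assumes cl: "closed (gph G)" and l: "0 \<le> l" and y: "y \<in> G x"
    and bound: "\<And>u v us vs. v \<in> G u \<Longrightarrow> norm (u - x') \<le> norm (x - x') \<Longrightarrow>
      norm (v - y) \<le> 2 * (l + 1) * norm (x - x') \<Longrightarrow>
      us \<in> coderivative G u v vs \<Longrightarrow> norm us \<le> l * norm vs"
  shows "\<exists>y'\<in>G x'. norm (y - y') \<le> 2 * (l + 1) * norm (x - x')"
proof (cases "x = x'")
  case True
  with y l show ?thesis by (auto intro!: bexI[of _ y])
next
  case False
  define d where "d = norm (x - x')"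
  define r where "r = 2 * (l + 1) * d"
  define c where "c = d / r\<^sup>2"
  define f where "f = (\<lambda>z. norm (fst z - x') + c * ((snd z - y) \<bullet> (snd z - y)))"
  define S where "S = gph G \<inter> cball x' d \<times> cball y r"
  have d: "d > 0" using False by (simp add: d_def)
  have r: "r > 0" using l d by (simp add: r_def)
  have c: "c > 0" using d r by (simp add: c_def)
  \<comment> \<open>Restricting the closed graph to a compact box secures a minimizer; it is shown
    below to be a minimizer over the whole graph.\<close>
  have "compact S" unfolding S_def by (intro closed_Int_compact cl compact_Times compact_cball)
  moreover have xyS: "(x, y) \<in> S"
    using y r by (auto simp: S_def gph_def d_def dist_norm norm_minus_commute)
  moreover have "continuous_on S f" unfolding f_def by (intro continuous_intros)
  ultimately obtain z where z: "z \<in> S" and zmin: "\<And>w. w \<in> S \<Longrightarrow> f z \<le> f w"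
    using continuous_attains_inf[of S f] by blast
  obtain u v where uv: "z = (u, v)" by (cases z)
  have v: "v \<in> G u" and u_d: "norm (u - x') \<le> d" and v_r: "norm (v - y) \<le> r"
    using z by (auto simp: S_def uv gph_def dist_norm norm_minus_commute)
  show ?thesis
  proof (cases "u = x'")
    case True
    with v v_r show ?thesis unfolding r_def d_def by (metis norm_minus_commute)
  next
    case u: False
    have fxy: "f (x, y) = d" by (simp add: f_def d_def)
    \<comment> \<open>Outside the box one of the two summands of \<open>f\<close> alone reaches
      \<open>d\<close>, the value of \<open>f\<close> at \<open>(x, y)\<close>: the first by its
      distance term, the second because \<open>c * r\<^sup>2 = d\<close>. Hence it does not matter
      whether \<open>z\<close> lies on the boundary of the box.\<close>
    have gmin: "f z \<le> f w" if w: "w \<in> gph G" for w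
    proof (cases "w \<in> S")
      case True
      then show ?thesis by (rule zmin)
    next
      case False
      have nn: "0 \<le> c * ((snd w - y) \<bullet> (snd w - y))" using c by simp
      from False w consider "norm (fst w - x') > d" | "norm (snd w - y) > r"
        by (cases w) (force simp: S_def dist_norm norm_minus_commute)
      then have "d \<le> f w"
      proof cases
        case 1
        with nn show ?thesis by (simp add: f_def)
      next
        case 2
        then have "r\<^sup>2 \<le> (snd w - y) \<bullet> (snd w - y)"
          using r by (simp add: dot_square_norm power_mono)
        then have "c * r\<^sup>2 \<le> c * ((snd w - y) \<bullet> (snd w - y))" using c by simp
        moreover have "c * r\<^sup>2 = d" using r by (simp add: c_def)
        ultimately show ?thesis unfolding f_def by (smt (verit) norm_ge_zero)
      qed
      with zmin[OF xyS] fxy show ?thesis by simp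
    qed
    have "((\<lambda>z::'a \<times> 'b. fst z - x') has_derivative fst) (at (u, v))"
      by (auto intro!: derivative_eq_intros)
    \<comment> \<open>The norm is differentiable at \<open>u - x'\<close> because \<open>u\<close>
      differs from \<open>x'\<close> in this case.\<close>
    from has_derivative_compose[OF this, of norm "\<lambda>h. h \<bullet> sgn (u - x')"]
    have "((\<lambda>z::'a \<times> 'b. norm (fst z - x')) has_derivative (\<lambda>h. fst h \<bullet> sgn (u - x'))) (at (u, v))"
      using has_derivative_norm[of "u - x'"] u by simp
    moreover have "((\<lambda>z::'a \<times> 'b. c * ((snd z - y) \<bullet> (snd z - y))) has_derivative
        (\<lambda>h. 2 * c * (snd h \<bullet> (v - y)))) (at (u, v))"
      by (auto intro!: derivative_eq_intros simp: fun_eq_iff inner_commute)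
    ultimately have der: "(f has_derivative (\<lambda>h. - ((- sgn (u - x'), - ((2 * c) *\<^sub>R (v - y))) \<bullet> h))) (at z)"
      unfolding f_def uv
      by (rule has_derivative_eq_rhs[OF has_derivative_add])
        (simp add: inner_prod_def fun_eq_iff inner_commute)
    have "(- sgn (u - x'), - ((2 * c) *\<^sub>R (v - y))) \<in> regular_normal_cone (u, v) (gph G)"
      using minimizer_regular_normal[of z "gph G" f, OF _ gmin der] z
      unfolding S_def uv by blast
    from bound[OF v _ _ regular_normal_imp_coderivative[OF this]] u_d v_r
    have "norm (- sgn (u - x')) \<le> l * norm ((2 * c) *\<^sub>R (v - y))" by (simp add: d_def r_def)
    then have "1 \<le> l * (2 * c * norm (v - y))" using u c by (simp add: norm_sgn)
    also have "\<dots> \<le> l * (2 * c * r)" using l c v_r by (intro mult_left_mono) auto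
    also have "\<dots> = l / (l + 1)"
      using l d by (simp add: c_def r_def power2_eq_square divide_simps)
    also have "\<dots> < 1" using l by simp
    finally show ?thesis by simp
  qed
qed

text \<open>Moving \<open>u\<close> by a small \<open>s\<close> in the direction of
  \<open>us\<close> gains \<open>s * norm us\<close> in the inner product. The Lipschitz condition
  supplies a graph point whose second component moves by at most \<open>l * s\<close>, which costs
  at most \<open>norm vs * (l * s)\<close>. Dividing the normal inequality by \<open>s\<close>
  leaves an arbitrarily small error.\<close>

lemma regular_normal_norm_le:
  fixes G :: "'a::euclidean_space \<Rightarrow> 'b::euclidean_space set"
  assumes n: "(us, - vs) \<in> regular_normal_cone (u, v) (gph G)" and l: "0 \<le> l" and \<delta>: "\<delta> > 0"
    and lip: "\<And>u'. norm (u' - u) < \<delta> \<Longrightarrow> \<exists>v'\<in>G u'. norm (v' - v) \<le> l * norm (u' - u)"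
  shows "norm us \<le> l * norm vs"
proof (cases "us = 0")
  case True
  with l show ?thesis by simp
next
  case us: False
  show ?thesis
  proof (rule field_le_epsilon)
    fix e' :: real assume "e' > 0"
    \<comment> \<open>The graph point lies within \<open>s * (1 + l)\<close> of
      \<open>(u, v)\<close>, so this choice makes the final error, after division by
      \<open>s\<close>, exactly \<open>e'\<close>.\<close>
    define e where "e = e' / (1 + l)"
    have e: "e > 0" "e * (1 + l) = e'" using \<open>e' > 0\<close> l by (auto simp: e_def)
    from n e(1) have "\<forall>\<^sub>F w in at (u, v) within gph G.
        (us, - vs) \<bullet> (w - (u, v)) \<le> e * norm (w - (u, v))"
      by (auto simp: regular_normal_cone_iff)
    then obtain d where d: "d > 0" and
      D: "\<And>w. w \<in> gph G \<Longrightarrow> w \<noteq> (u, v) \<Longrightarrow> dist w (u, v) < d \<Longrightarrow>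
        (us, - vs) \<bullet> (w - (u, v)) \<le> e * norm (w - (u, v))"
      unfolding eventually_at by blast
    \<comment> \<open>The first bound keeps \<open>u'\<close> where the Lipschitz condition applies,
      the second keeps the resulting graph point where the normal inequality holds.\<close>
    define s where "s = min (\<delta> / 2) (d / (2 * (1 + l)))"
    have s: "s > 0" "s < \<delta>" using \<delta> d l by (auto simp: s_def intro: min.strict_coboundedI1)
    have "s * (1 + l) \<le> d / (2 * (1 + l)) * (1 + l)"
      using l by (intro mult_right_mono) (auto simp: s_def)
    also have "\<dots> = d / 2" using l by (simp add: divide_simps)
    also have "\<dots> < d" using d by simp
    finally have sd: "s * (1 + l) < d" .
    define u' where "u' = u + s *\<^sub>R sgn us"
    have nu: "norm (u' - u) = s" using us s by (simp add: u'_def norm_sgn)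
    from lip[of u'] nu s obtain v' where v': "v' \<in> G u'" "norm (v' - v) \<le> l * s" by auto
    have "norm ((u', v') - (u, v)) \<le> norm (u' - u) + norm (v' - v)"
      by (simp add: norm_Pair sqrt_sum_squares_le_sum)
    also have "\<dots> \<le> s * (1 + l)" using nu v' by (simp add: algebra_simps)
    finally have nrm: "norm ((u', v') - (u, v)) \<le> s * (1 + l)" .
    have "s * norm us = us \<bullet> (u' - u)"
      using us by (simp add: u'_def sgn_div_norm dot_square_norm power2_eq_square)
    also have "\<dots> = (us, - vs) \<bullet> ((u', v') - (u, v)) + vs \<bullet> (v' - v)" by simp
    also have "\<dots> \<le> e * norm ((u', v') - (u, v)) + norm vs * norm (v' - v)"
      using v' nu s sd nrm
      by (intro add_mono D norm_cauchy_schwarz) (auto simp: gph_def dist_norm)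
    also have "\<dots> \<le> e * (s * (1 + l)) + norm vs * (l * s)"
      using nrm v' e by (intro add_mono mult_left_mono) auto
    also have "\<dots> = s * (l * norm vs + e')" by (simp flip: e(2) add: algebra_simps)
    finally show "norm us \<le> l * norm vs + e'" using s by simp
  qed
qed

text \<open>The balls are open so that base points converging to \<open>(u, v)\<close> eventually
  enter them. There the bound holds for regular normals, and it is preserved in the limit.\<close>

lemma Lipschitz_imp_coderivative_bound:
  fixes G :: "'a::euclidean_space \<Rightarrow> 'b::euclidean_space set"
  assumes lip: "\<And>u u' v. u \<in> ball x \<rho> \<Longrightarrow> u' \<in> ball x \<rho> \<Longrightarrow> v \<in> G u \<Longrightarrow> v \<in> ball y \<sigma> \<Longrightarrow>
      \<exists>v'\<in>G u'. norm (v' - v) \<le> l * norm (u' - u)"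
    and l: "0 \<le> l" and u: "u \<in> ball x \<rho>" and v: "v \<in> ball y \<sigma>"
    and us: "us \<in> coderivative G u v vs"
  shows "norm us \<le> l * norm vs"
proof -
  from us obtain z s where z: "z \<longlonglongrightarrow> (u, v)" and s: "s \<longlonglongrightarrow> (us, - vs)"
    and n: "\<And>k::nat. s k \<in> regular_normal_cone (z k) (gph G)"
    by (auto simp: coderivative_def limiting_normal_cone_def)
  have "open (ball x \<rho> \<times> ball y \<sigma>)" by (intro open_Times open_ball)
  with z u v have "\<forall>\<^sub>F k in sequentially. z k \<in> ball x \<rho> \<times> ball y \<sigma>"
    by (intro topological_tendstoD) auto
  then have "\<forall>\<^sub>F k in sequentially. norm (fst (s k)) \<le> l * norm (- snd (s k))"
  proof eventually_elim
    case (elim k)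
    obtain p q where pq: "z k = (p, q)" by (cases "z k")
    with elim have p: "p \<in> ball x \<rho>" and q: "q \<in> ball y \<sigma>" by auto
    from p obtain \<delta> where \<delta>: "\<delta> > 0" "ball p \<delta> \<subseteq> ball x \<rho>"
      using open_contains_ball[of "ball x \<rho>"] open_ball by blast
    have nk: "(fst (s k), - (- snd (s k))) \<in> regular_normal_cone (p, q) (gph G)"
      using n[of k] pq by simp
    then have "q \<in> G p" by (simp add: regular_normal_cone_iff gph_def)
    then show ?case
    proof (intro regular_normal_norm_le[OF nk l \<delta>(1)])
      fix u' assume "norm (u' - p) < \<delta>"
      with \<delta>(2) have "u' \<in> ball x \<rho>" by (auto simp: dist_norm norm_minus_commute)
      with lip p q \<open>q \<in> G p\<close> show "\<exists>v'\<in>G u'. norm (v' - q) \<le> l * norm (u' - p)" by blast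
    qed
  qed
  moreover have "(\<lambda>k. norm (fst (s k))) \<longlonglongrightarrow> norm us"
    using tendsto_norm[OF tendsto_fst[OF s]] by simp
  moreover have "(\<lambda>k. l * norm (- snd (s k))) \<longlonglongrightarrow> l * norm vs"
    using tendsto_mult_left[OF tendsto_norm[OF tendsto_minus[OF tendsto_snd[OF s]]], of l] by simp
  ultimately show ?thesis by (intro tendsto_le[of sequentially]) auto
qed

section \<open>Scaled balls, Lebesgue space bounds and localization to an atom\<close>

lemma mem_scaled_unit_cball:
  fixes w :: "'a::real_normed_vector"
  assumes "0 \<le> r"
  shows "w \<in> (*\<^sub>R) r ` cball 0 1 \<longleftrightarrow> norm w \<le> r"
proof
  assume "w \<in> (*\<^sub>R) r ` cball 0 1"
  then obtain b where "w = r *\<^sub>R b" "norm b \<le> 1" by (auto simp del: scaleR_cancel_left)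
  with assms show "norm w \<le> r" by (simp add: mult_left_le)
next
  assume w: "norm w \<le> r"
  show "w \<in> (*\<^sub>R) r ` cball 0 1"
  proof (cases "r = 0")
    case True
    with w show ?thesis by (auto intro: image_eqI[of _ _ 0])
  next
    case False
    with w assms show ?thesis
      by (intro image_eqI[of _ _ "w /\<^sub>R r"]) (auto simp: field_simps)
  qed
qed

lemma Linf_norm_le:
  assumes [measurable]: "f \<in> borel_measurable M" and "AE t in M. norm (f t) \<le> c"
  shows "Linf_norm M f \<le> ereal c"
  unfolding Linf_norm_def using assms(2) by (intro esssup_I) auto

lemma AE_norm_le_Linf_norm:
  assumes [measurable]: "f \<in> borel_measurable M" and "Linf_norm M f \<le> ereal c"
  shows "AE t in M. norm (f t) \<le> c"
proof -
  have "AE t in M. ereal (norm (f t)) \<le> Linf_norm M f"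
    unfolding Linf_norm_def by (rule esssup_AE)
  then show ?thesis
    by (rule eventually_mono) (use assms(2) order_trans ereal_less_eq(3) in blast)
qed

lemma Linf_AE_bounded:
  assumes "f \<in> Linf M"
  obtains c where "0 \<le> c" "AE t in M. norm (f t) \<le> c"
proof -
  from assms have f: "f \<in> borel_measurable M" "Linf_norm M f < \<infinity>" by (auto simp: Linf_def)
  then obtain c where "Linf_norm M f \<le> ereal c"
    by (metis ereal_dense2 less_imp_le)
  then have "Linf_norm M f \<le> ereal (max 0 c)" by (rule order_trans) simp
  from AE_norm_le_Linf_norm[OF f(1) this] show thesis by (intro that[of "max 0 c"]) auto
qed

lemma AE_bounded_imp_Linf:
  assumes "f \<in> borel_measurable M" and "AE t in M. norm (f t) \<le> c"
  shows "f \<in> Linf M"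
  using Linf_norm_le[OF assms] assms(1) by (auto simp: Linf_def)

lemma integrable_If_const:
  fixes f :: "'t \<Rightarrow> 'b::euclidean_space"
  assumes "finite_measure M" and A: "A \<in> sets M" and f: "integrable M f"
  shows "integrable M (\<lambda>t. if t \<in> A then v else f t)"
proof -
  interpret finite_measure M by fact
  have "integrable M (\<lambda>t. indicator A t *\<^sub>R (v - f t) + f t)"
    using A f by (intro Bochner_Integration.integrable_add integrable_mult_indicator
      Bochner_Integration.integrable_diff integrable_const)
  then show ?thesis
    by (rule back_subst[of "integrable M"]) (auto simp: indicator_def)
qed

text \<open>Functions on \<open>M\<close> that differ from the reference selection only on the atom \<open>A\<close> turn the
  integral condition into a bound for \<open>G\<close> at every point of its graph in a product of balls.\<close>

lemma integrably_quasi_Lipschitzian_on_atom: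
  fixes \<Phi> :: "'t \<Rightarrow> 'a::euclidean_space \<Rightarrow> 'b::euclidean_space set"
  assumes fin: "finite_measure M" and A: "measure_atom M A"
    and IQL: "\<forall>x\<in>Linf M. \<forall>y\<in>L1 M. \<forall>ys\<in>Linf M.
        Linf_norm M (\<lambda>t. x t - xb) \<le> ereal \<eta> \<longrightarrow> L1_norm M (\<lambda>t. y t - yf t) \<le> \<eta> \<longrightarrow>
        (AE t in M. y t \<in> \<Phi> t (x t)) \<longrightarrow>
        (AE t in M. (SUP xs \<in> coderivative (\<Phi> t) (x t) (y t) (ys t). ereal (norm xs))
                      \<le> ereal (l t * norm (ys t)))"
    and \<eta>: "0 \<le> \<eta>" and yf: "yf \<in> L1 M" "AE t in M. yf t \<in> \<Phi> t xb"
    and G: "AE t in M. t \<in> A \<longrightarrow> \<Phi> t = G"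
    and c: "AE t in M. t \<in> A \<longrightarrow> yf t = c" and \<kappa>: "AE t in M. t \<in> A \<longrightarrow> l t = \<kappa>"
    and u: "norm (u - xb) \<le> \<eta>" and v: "v \<in> G u" "norm (v - c) * measure M A \<le> \<eta>"
    and us: "us \<in> coderivative G u v vs"
  shows "norm us \<le> \<kappa> * norm vs"
proof -
  interpret finite_measure M by fact
  have sA [measurable]: "A \<in> sets M" using A by (simp add: measure_atom_def)
  have yfi: "integrable M yf" using yf by (simp add: L1_def)
  define x where "x = (\<lambda>t. if t \<in> A then u else xb)"
  define y where "y = (\<lambda>t. if t \<in> A then v else yf t)"
  define ys where "ys = (\<lambda>t. if t \<in> A then vs else 0)"
  have [measurable]: "x \<in> borel_measurable M" "ys \<in> borel_measurable M"
    unfolding x_def ys_def by measurable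
  have "x \<in> Linf M"
    by (rule AE_bounded_imp_Linf[where c = "max (norm u) (norm xb)"]) (auto simp: x_def)
  moreover have "y \<in> L1 M"
    using integrable_If_const[OF fin sA yfi] by (simp add: L1_def y_def)
  moreover have "ys \<in> Linf M"
    by (rule AE_bounded_imp_Linf[where c = "norm vs"]) (auto simp: ys_def)
  moreover have "Linf_norm M (\<lambda>t. x t - xb) \<le> ereal \<eta>"
    by (rule Linf_norm_le) (use u \<eta> in \<open>auto simp: x_def\<close>)
  moreover have "L1_norm M (\<lambda>t. y t - yf t) \<le> \<eta>"
  proof -
    \<comment> \<open>The perturbation vanishes off the atom and has norm
      \<open>norm (v - c)\<close> almost everywhere on it.\<close>
    have "(\<integral>t. norm (y t - yf t) \<partial>M) = (\<integral>t. indicator A t *\<^sub>R norm (v - c) \<partial>M)"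
    proof (rule integral_cong_AE)
      show "(\<lambda>t. norm (y t - yf t)) \<in> borel_measurable M"
        using \<open>y \<in> L1 M\<close> yfi by (auto simp: L1_def)
      show "AE t in M. norm (y t - yf t) = indicator A t *\<^sub>R norm (v - c)"
        using c by eventually_elim (auto simp: y_def)
    qed measurable
    also have "\<dots> = norm (v - c) * measure M A" using sA by simp
    finally show ?thesis using v by (simp add: L1_norm_def)
  qed
  moreover have "AE t in M. y t \<in> \<Phi> t (x t)"
    using yf(2) G by eventually_elim (use v in \<open>auto simp: x_def y_def\<close>)
  ultimately have "AE t in M. (SUP xs \<in> coderivative (\<Phi> t) (x t) (y t) (ys t). ereal (norm xs))
      \<le> ereal (l t * norm (ys t))"
    by (rule IQL[rule_format])
  with G \<kappa> have "AE t in M. t \<in> A \<longrightarrow> norm us \<le> \<kappa> * norm vs"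
    by eventually_elim (use us in \<open>auto simp: x_def y_def ys_def SUP_le_iff\<close>)
  \<comment> \<open>The inequality no longer mentions \<open>t\<close>, so one point of the atom
    suffices.\<close>
  from atom_AE_imp_ex[OF A this] show ?thesis by blast
qed

text \<open>Being almost everywhere constant on the atom, \<open>f\<close> has there an integral of
  its norm equal to that constant norm times the mass. This is the source of the radius
  \<open>\<gamma> / measure M (T k)\<close> in the inclusion.\<close>

lemma atom_norm_le_L1_norm:
  fixes f :: "'t \<Rightarrow> 'b::euclidean_space"
  assumes fin: "finite_measure M" and A: "measure_atom M A" and f: "integrable M f"
  shows "AE t in M. t \<in> A \<longrightarrow> norm (f t) * measure M A \<le> L1_norm M f"
proof -
  interpret finite_measure M by fact
  have sA: "A \<in> sets M" using A by (simp add: measure_atom_def)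
  obtain c where c: "AE t in M. t \<in> A \<longrightarrow> f t = c"
    using atom_AE_const[OF fin A borel_measurable_integrable[OF f]] by blast
  have "norm c * measure M A = (\<integral>t. indicator A t *\<^sub>R norm c \<partial>M)" using sA by simp
  also have "\<dots> \<le> L1_norm M f"
    unfolding L1_norm_def
  proof (rule integral_mono_AE)
    show "integrable M (\<lambda>t. indicator A t *\<^sub>R norm c)"
      using sA by (intro integrable_mult_indicator integrable_const)
    show "AE t in M. indicator A t *\<^sub>R norm c \<le> norm (f t)"
      using c by eventually_elim (auto simp: indicator_def)
  qed (use f in auto)
  finally show ?thesis using c by (auto elim: eventually_mono)
qed

section \<open>From the coderivative bound to the inclusion on every atom, and back\<close>

theorem theorem4p7:
  fixes M :: "'t measure"
    and T :: "nat \<Rightarrow> 't set"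
    and \<Phi> :: "'t \<Rightarrow> real ^ 'n \<Rightarrow> (real ^ 'm) set"
    and xb :: "real ^ 'n"
    and yb :: "real ^ 'm"
    and yf :: "'t \<Rightarrow> real ^ 'm"
  assumes "complete_measure M" and "finite_measure M"
    and "\<And>k. measure_atom M (T k)" and "disjoint_family T" and "(\<Union>k. T k) = space M"
    and "normal_integrand M \<Phi>"
    and "(xb, yb) \<in> gph (aumann_integral M \<Phi>)"
    and "yf \<in> selections M \<Phi> xb yb"
  shows "(integrably_quasi_Lipschitzian M \<Phi> xb yf \<longrightarrow>
            (\<exists>\<gamma>>0. \<exists>l\<in>L1_pos M. \<forall>k. Lipschitz_inclusion_on M (T k) \<Phi> xb yf \<gamma> l))
       \<and> ((\<exists>\<gamma>>0. \<exists>l\<in>Linf_pos M. \<forall>k. Lipschitz_inclusion_on M (T k) \<Phi> xb yf \<gamma> l) \<longrightarrow>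
            integrably_quasi_Lipschitzian M \<Phi> xb yf)"
proof (intro conjI impI)
  interpret finite_measure M by fact
  note fin = \<open>finite_measure M\<close> and atom = \<open>\<And>k. measure_atom M (T k)\<close>
  have yfL: "yf \<in> L1 M" and yf\<Phi>: "AE t in M. yf t \<in> \<Phi> t xb"
    using assms(8) by (auto simp: selections_def)
  then have yfi: "integrable M yf" by (simp add: L1_def)
  have \<mu>: "measure M (T k) > 0" for k
    using atom[of k] by (simp add: measure_atom_def emeasure_eq_measure)
  \<comment> \<open>The total mass bounds the mass of each atom, which makes \<open>\<gamma>\<close>
    below independent of \<open>k\<close>.\<close>
  define m where "m = measure M (space M)"
  have \<mu>m: "measure M (T k) \<le> m" for k unfolding m_def by (rule bounded_measure)
  {
    assume "integrably_quasi_Lipschitzian M \<Phi> xb yf"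
    then obtain \<eta> l where \<eta>: "\<eta> > 0" and l: "l \<in> L1_pos M" and
      IQL: "\<forall>x\<in>Linf M. \<forall>y\<in>L1 M. \<forall>ys\<in>Linf M.
        Linf_norm M (\<lambda>t. x t - xb) \<le> ereal \<eta> \<longrightarrow> L1_norm M (\<lambda>t. y t - yf t) \<le> \<eta> \<longrightarrow>
        (AE t in M. y t \<in> \<Phi> t (x t)) \<longrightarrow>
        (AE t in M. (SUP xs \<in> coderivative (\<Phi> t) (x t) (y t) (ys t). ereal (norm xs))
                      \<le> ereal (l t * norm (ys t)))"
      unfolding integrably_quasi_Lipschitzian_def by (elim exE conjE bexE) (rule that)
    have li: "integrable M l" and lpos: "AE t in M. 0 < l t"
      using l by (auto simp: L1_pos_def L1_def)
    \<comment> \<open>Points compared in the minimization lie within \<open>3 * \<gamma>\<close> of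
      \<open>xb\<close> and deviate from the selection by at most
      \<open>(2 * m + 1) * \<gamma>\<close> after weighting with the mass; both must stay below
      \<open>\<eta>\<close>.\<close>
    define \<gamma> where "\<gamma> = \<eta> / (2 * m + 3)"
    \<comment> \<open>The modulus delivered by \<open>coderivative_bound_imp_Lipschitz\<close>; it
      is integrable because the measure is finite.\<close>
    define l' where "l' = (\<lambda>t. 2 * (l t + 1))"
    have m: "0 \<le> m" by (simp add: m_def)
    have \<gamma>: "\<gamma> > 0" "3 * \<gamma> \<le> \<eta>" "(2 * m + 1) * \<gamma> \<le> \<eta>"
      using \<eta> m by (auto simp: \<gamma>_def field_simps)
    have "integrable M l'" unfolding l'_def using li by auto
    moreover have "AE t in M. 0 < l' t" using lpos by (auto simp: l'_def elim: eventually_mono)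
    ultimately have l': "l' \<in> L1_pos M" by (simp add: L1_pos_def L1_def)
    have "Lipschitz_inclusion_on M (T k) \<Phi> xb yf \<gamma> l'" for k
    proof -
      obtain G where G: "closed (gph G)" "AE t in M. t \<in> T k \<longrightarrow> \<Phi> t = G"
        using atom_AE_normal_integrand_const[OF fin atom assms(6)] by blast
      obtain c where c: "AE t in M. t \<in> T k \<longrightarrow> yf t = c"
        using atom_AE_const[OF fin atom borel_measurable_integrable[OF yfi]] by blast
      obtain \<kappa> where \<kappa>: "AE t in M. t \<in> T k \<longrightarrow> l t = \<kappa>"
        using atom_AE_const[OF fin atom borel_measurable_integrable[OF li]] by blast
      have bound: "norm us \<le> \<kappa> * norm vs"
        if "norm (u - xb) \<le> \<eta>" "v \<in> G u" "norm (v - c) * measure M (T k) \<le> \<eta>"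
          "us \<in> coderivative G u v vs" for u v us vs
        by (rule integrably_quasi_Lipschitzian_on_atom[OF fin atom IQL less_imp_le[OF \<eta>] yfL yf\<Phi> G(2) c \<kappa> that])
      have "AE t in M. t \<in> T k \<longrightarrow> 0 < \<kappa>" using \<kappa> lpos by eventually_elim auto
      from atom_AE_imp_ex[OF atom this] have \<kappa>pos: "0 < \<kappa>" by blast
      have incl: "\<exists>y'\<in>G x'. norm (y - y') \<le> 2 * (\<kappa> + 1) * norm (x - x')"
        if x: "norm (x - xb) \<le> \<gamma> / (2 * (\<kappa> + 1) + 1)"
          and x': "norm (x' - xb) \<le> \<gamma> / (2 * (\<kappa> + 1) + 1)"
          and y: "y \<in> G x" "norm (y - c) \<le> \<gamma> / measure M (T k)" for x x' y
      proof (rule coderivative_bound_imp_Lipschitz[OF G(1) _ y(1)])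
        fix u v us vs
        assume v: "v \<in> G u" and u_le: "norm (u - x') \<le> norm (x - x')"
          and v_le: "norm (v - y) \<le> 2 * (\<kappa> + 1) * norm (x - x')"
          and us: "us \<in> coderivative G u v vs"
        have "norm (x - x') \<le> norm (x - xb) + norm (x' - xb)"
          using norm_triangle_ineq4[of "x - xb" "x' - xb"] by simp
        also have "\<dots> \<le> 2 * \<gamma> / (2 * (\<kappa> + 1) + 1)" using x x' by simp
        \<comment> \<open>Clearing the denominator of the radius controls two distances at once: the
          multiple by \<open>2 * (\<kappa> + 1)\<close> limits how far \<open>v\<close> is from
          \<open>y\<close>, and the summand from the extra \<open>1\<close> limits how far
          \<open>u\<close> is from \<open>x'\<close>.\<close>
        finally have "2 * (\<kappa> + 1) * norm (x - x') + norm (x - x') \<le> 2 * \<gamma>"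
          using \<kappa>pos by (simp add: pos_le_divide_eq distrib_left mult.commute)
        moreover have "0 \<le> 2 * (\<kappa> + 1) * norm (x - x')" using \<kappa>pos by simp
        ultimately have d: "norm (x - x') \<le> 2 * \<gamma>" "2 * (\<kappa> + 1) * norm (x - x') \<le> 2 * \<gamma>"
          using norm_ge_zero[of "x - x'"] by linarith+
        have "\<gamma> / (2 * (\<kappa> + 1) + 1) \<le> \<gamma>" using \<gamma> \<kappa>pos by (simp add: field_simps)
        then have "norm (u - xb) \<le> \<eta>"
          using norm_triangle_ineq[of "u - x'" "x' - xb"] u_le d x' \<gamma> by simp
        moreover have "norm (v - c) * measure M (T k) \<le> \<eta>"
        proof -
          have "norm (v - c) \<le> 2 * \<gamma> + \<gamma> / measure M (T k)"
            using norm_triangle_ineq[of "v - y" "y - c"] v_le d y by simp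
          then have "norm (v - c) * measure M (T k) \<le> (2 * \<gamma> + \<gamma> / measure M (T k)) * measure M (T k)"
            by (intro mult_right_mono) auto
          also have "\<dots> = 2 * \<gamma> * measure M (T k) + \<gamma>" using \<mu>[of k] by (simp add: field_simps)
          also have "\<dots> \<le> 2 * \<gamma> * m + \<gamma>" using \<gamma> \<mu>m[of k] by simp
          also have "\<dots> \<le> \<eta>" using \<gamma> by (simp add: algebra_simps)
          finally show ?thesis .
        qed
        ultimately show "norm us \<le> \<kappa> * norm vs" using bound v us by blast
      qed (use \<kappa>pos in simp)
      show ?thesis
        unfolding Lipschitz_inclusion_on_def using G(2) c \<kappa>
      proof eventually_elim
        case (elim t)
        show ?case
        proof (intro impI ballI subsetI)
          fix x x' y
          assume t: "t \<in> T k" and x: "x \<in> cball xb (\<gamma> / (l' t + 1))"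
            and x': "x' \<in> cball xb (\<gamma> / (l' t + 1))"
            and y: "y \<in> \<Phi> t x \<inter> cball (yf t) (\<gamma> / measure M (T k))"
          have eqs: "\<Phi> t = G" "yf t = c" "l' t = 2 * (\<kappa> + 1)"
            using elim t by (auto simp: l'_def)
          obtain y' where y': "y' \<in> G x'" "norm (y - y') \<le> 2 * (\<kappa> + 1) * norm (x - x')"
            using incl[of x x' y] x x' y unfolding eqs by (auto simp: dist_norm norm_minus_commute)
          then have "y - y' \<in> (*\<^sub>R) (l' t * norm (x - x')) ` cball 0 1"
            unfolding eqs using \<kappa>pos by (subst mem_scaled_unit_cball) auto
          with y' have "y' + (y - y') \<in> \<Phi> t x' + (*\<^sub>R) (l' t * norm (x - x')) ` cball 0 1"
            unfolding eqs by (intro set_plus_intro)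
          then show "y \<in> \<Phi> t x' + (*\<^sub>R) (l' t * norm (x - x')) ` cball 0 1" by simp
        qed
      qed
    qed
    with \<gamma> l' show "\<exists>\<gamma>>0. \<exists>l\<in>L1_pos M. \<forall>k. Lipschitz_inclusion_on M (T k) \<Phi> xb yf \<gamma> l"
      by blast
  }
  assume "\<exists>\<gamma>>0. \<exists>l\<in>Linf_pos M. \<forall>k. Lipschitz_inclusion_on M (T k) \<Phi> xb yf \<gamma> l"
  then obtain \<gamma> l where \<gamma>: "\<gamma> > 0" and l: "l \<in> Linf M" "AE t in M. 0 < l t"
    and incl: "\<And>k. Lipschitz_inclusion_on M (T k) \<Phi> xb yf \<gamma> l"
    by (auto simp: Linf_pos_def)
  from l(1) obtain L where L: "0 \<le> L" "AE t in M. norm (l t) \<le> L" by (rule Linf_AE_bounded)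
  \<comment> \<open>An essentially bounded function is integrable for a finite measure, so
    \<open>l\<close> itself can serve as the modulus.\<close>
  have "integrable M l"
    using l(1) L(2) by (intro integrable_const_bound[of _ L]) (auto simp: Linf_def)
  with l have lpos: "l \<in> L1_pos M" by (simp add: L1_pos_def L1_def)
  \<comment> \<open>The factor \<open>2\<close> makes both inequalities below strict, as the open
    balls require: \<open>\<eta> < \<gamma> / (L + 1)\<close> places \<open>x t\<close>, and
    \<open>\<eta> < \<gamma>\<close>, after division by the mass of the atom, places
    \<open>y t\<close>.\<close>
  define \<eta> where "\<eta> = \<gamma> / (2 * (L + 1))"
  have \<eta>: "\<eta> > 0" "\<eta> < \<gamma>" "\<eta> < \<gamma> / (L + 1)"
    using \<gamma> L(1) by (auto simp: \<eta>_def field_simps intro: add_pos_nonneg)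
  show "integrably_quasi_Lipschitzian M \<Phi> xb yf"
    unfolding integrably_quasi_Lipschitzian_def
  proof (rule exI[of _ \<eta>], intro conjI bexI[OF _ lpos] ballI impI)
    fix x :: "'t \<Rightarrow> real ^ 'n" and y ys :: "'t \<Rightarrow> real ^ 'm"
    assume x: "x \<in> Linf M" and y: "y \<in> L1 M"
      and x\<eta>: "Linf_norm M (\<lambda>t. x t - xb) \<le> ereal \<eta>"
      and y\<eta>: "L1_norm M (\<lambda>t. y t - yf t) \<le> \<eta>"
    have "x \<in> borel_measurable M" using x by (simp add: Linf_def)
    then have xAE: "AE t in M. norm (x t - xb) \<le> \<eta>"
      by (intro AE_norm_le_Linf_norm x\<eta>) auto
    have "AE t in M. t \<in> T k \<longrightarrow>
        (SUP xs \<in> coderivative (\<Phi> t) (x t) (y t) (ys t). ereal (norm xs)) \<le> ereal (l t * norm (ys t))"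
      for k
    proof -
      have "integrable M (\<lambda>t. y t - yf t)" using y yfi by (simp add: L1_def)
      from atom_norm_le_L1_norm[OF fin atom this]
      have "AE t in M. t \<in> T k \<longrightarrow> norm (y t - yf t) * measure M (T k) \<le> L1_norm M (\<lambda>t. y t - yf t)" .
      with xAE l(2) L(2) incl[of k, unfolded Lipschitz_inclusion_on_def]
      show ?thesis
      \<comment> \<open>From here on the argument is pointwise in \<open>t\<close>; the atom has
        entered through the passage from the integral norm to a bound on
        \<open>y t - yf t\<close>.\<close>
      proof eventually_elim
        case (elim t)
        show ?case
        proof
          assume t: "t \<in> T k"
          have lt: "0 < l t" "l t \<le> L" using elim by auto
          have "\<gamma> / (L + 1) \<le> \<gamma> / (l t + 1)" using \<gamma> lt by (intro divide_left_mono) auto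
          then have xt: "x t \<in> ball xb (\<gamma> / (l t + 1))"
            using elim(1) \<eta> by (simp add: dist_norm norm_minus_commute)
          have "norm (y t - yf t) * measure M (T k) < \<gamma>" using elim t y\<eta> \<eta> by simp
          then have yt: "y t \<in> ball (yf t) (\<gamma> / measure M (T k))"
            using \<mu>[of k] by (simp add: pos_less_divide_eq dist_norm norm_minus_commute)
          have "norm us \<le> l t * norm (ys t)"
            if us: "us \<in> coderivative (\<Phi> t) (x t) (y t) (ys t)" for us
          proof (rule Lipschitz_imp_coderivative_bound[OF _ _ xt yt us])
            fix u u' v
            assume uv: "u \<in> ball xb (\<gamma> / (l t + 1))" "u' \<in> ball xb (\<gamma> / (l t + 1))"
              "v \<in> \<Phi> t u" "v \<in> ball (yf t) (\<gamma> / measure M (T k))"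
            then have "v \<in> \<Phi> t u' + (*\<^sub>R) (l t * norm (u - u')) ` cball 0 1"
              using elim(4) t by (auto simp: subset_iff)
            then obtain v' w where w: "v' \<in> \<Phi> t u'" "v = v' + w"
              "w \<in> (*\<^sub>R) (l t * norm (u - u')) ` cball 0 1"
              by (rule set_plus_elim)
            then have "norm w \<le> l t * norm (u - u')"
              using lt by (subst (asm) mem_scaled_unit_cball) auto
            with w show "\<exists>v'\<in>\<Phi> t u'. norm (v' - v) \<le> l t * norm (u' - u)"
              by (auto intro!: bexI[of _ v'] simp: norm_minus_commute)
          qed (use lt in simp)
          then show "(SUP xs \<in> coderivative (\<Phi> t) (x t) (y t) (ys t). ereal (norm xs))
              \<le> ereal (l t * norm (ys t))"
            by (simp add: SUP_le_iff)
        qed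
      qed
    qed
    \<comment> \<open>The atoms are countably many, so their exceptional null sets can be united;
      the atoms cover the space.\<close>
    then have "AE t in M. \<forall>k. t \<in> T k \<longrightarrow>
        (SUP xs \<in> coderivative (\<Phi> t) (x t) (y t) (ys t). ereal (norm xs)) \<le> ereal (l t * norm (ys t))"
      unfolding AE_all_countable by blast
    with AE_space show "AE t in M.
        (SUP xs \<in> coderivative (\<Phi> t) (x t) (y t) (ys t). ereal (norm xs)) \<le> ereal (l t * norm (ys t))"
      by eventually_elim (use assms(5) in blast)
  qed (use \<eta> in simp)
qed

end
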